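(* There is an infinite, countable, orderable, locally solvable and perfect WM group.
   Context: Groups are discrete. A group is WM (weakly mixing) if it has no non-trivial finite-dimensional unitary representations, i.e. every homomorphism from it to a unitary group $\operatorname{U}(n)$, $n\ge 1$, is trivial. A group is orderable if it has a linear (total) order invariant under both left and right multiplication. A group is locally solvable if all its finitely generated subgroups are solvable, and perfect if it equals its commutator subgroup. *)

theory Defs
  imports
    "HOL-Algebra.Solvable_Groups"
    "HOL-Library.Countable_Set"
    "Jordan_Normal_Form.Schur_Decomposition"
begin

definition unitary_group :: "nat \<Rightarrow> complex mat monoid" where
  "unitary_group n =
     \<lparr>carrier = {U \<in> carrier_mat n n. mat_adjoint U * U = 1\<^sub>m n \<and> U * mat_adjoint U = 1\<^sub>m n},
      monoid.mult = (*),
      one = 1\<^sub>m n\<rparr>"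

definition weakly_mixing :: "('a, 'b) monoid_scheme \<Rightarrow> bool" where
  "weakly_mixing G \<longleftrightarrow>
     (\<forall>n\<ge>1. \<forall>h \<in> hom G (unitary_group n). \<forall>g \<in> carrier G. h g = \<one>\<^bsub>unitary_group n\<^esub>)"

definition orderable :: "('a, 'b) monoid_scheme \<Rightarrow> bool" where
  "orderable G \<longleftrightarrow>
     (\<exists>r. linear_order_on (carrier G) r \<and>
        (\<forall>a \<in> carrier G. \<forall>b \<in> carrier G. \<forall>c \<in> carrier G. (a, b) \<in> r \<longrightarrow>
           (c \<otimes>\<^bsub>G\<^esub> a, c \<otimes>\<^bsub>G\<^esub> b) \<in> r \<and> (a \<otimes>\<^bsub>G\<^esub> c, b \<otimes>\<^bsub>G\<^esub> c) \<in> r))"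

definition locally_solvable :: "('a, 'b) monoid_scheme \<Rightarrow> bool" where
  "locally_solvable G \<longleftrightarrow>
     (\<forall>S \<subseteq> carrier G. finite S \<longrightarrow> solvable (G\<lparr>carrier := generate G S\<rparr>))"

definition perfect :: "('a, 'b) monoid_scheme \<Rightarrow> bool" where
  "perfect G \<longleftrightarrow> derived G (carrier G) = carrier G"

lemma mat_adjoint_carrier:
  "U \<in> carrier_mat n m \<Longrightarrow> mat_adjoint U \<in> carrier_mat m n"
  unfolding mat_adjoint_def by auto

lemma mat_adjoint_index:
  assumes "U \<in> carrier_mat n m" "i < m" "j < n"
  shows "mat_adjoint U $$ (i, j) = conjugate (U $$ (j, i))"
  using assms unfolding mat_adjoint_def by (auto simp: mat_of_rows_def)

lemma mat_adjoint_one: "mat_adjoint (1\<^sub>m n) = (1\<^sub>m n :: complex mat)"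
proof (rule eq_matI)
  fix i j assume "i < dim_row (1\<^sub>m n :: complex mat)" "j < dim_col (1\<^sub>m n :: complex mat)"
  then show "mat_adjoint (1\<^sub>m n) $$ (i, j) = (1\<^sub>m n :: complex mat) $$ (i, j)"
    by (subst mat_adjoint_index[of _ n n]) auto
qed (auto simp: mat_adjoint_def)

lemma mat_adjoint_adjoint:
  "U \<in> carrier_mat n m \<Longrightarrow> mat_adjoint (mat_adjoint U) = (U :: complex mat)"
  by (rule eq_matI)
    (auto simp: mat_adjoint_index[OF mat_adjoint_carrier] mat_adjoint_index
      dest: mat_adjoint_carrier[OF mat_adjoint_carrier])

lemma mat_adjoint_mult:
  assumes A: "(A :: complex mat) \<in> carrier_mat n m" and B: "B \<in> carrier_mat m k"
  shows "mat_adjoint (A * B) = mat_adjoint B * mat_adjoint A"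
proof (rule eq_matI)
  note C = mat_adjoint_carrier[OF A] mat_adjoint_carrier[OF B]
    mat_adjoint_carrier[OF mult_carrier_mat[OF A B]]
  show "dim_row (mat_adjoint (A * B)) = dim_row (mat_adjoint B * mat_adjoint A)"
    "dim_col (mat_adjoint (A * B)) = dim_col (mat_adjoint B * mat_adjoint A)"
    using C by auto
  fix i j assume "i < dim_row (mat_adjoint B * mat_adjoint A)"
    "j < dim_col (mat_adjoint B * mat_adjoint A)"
  then have ij: "i < k" "j < n" using C by auto
  have "mat_adjoint (A * B) $$ (i, j) = cnj (\<Sum>l<m. A $$ (j, l) * B $$ (l, i))"
    using A B ij by (subst mat_adjoint_index[OF mult_carrier_mat[OF A B]])
      (auto simp: scalar_prod_def atLeast0LessThan)
  also have "\<dots> = (\<Sum>l<m. mat_adjoint B $$ (i, l) * mat_adjoint A $$ (l, j))"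
    using ij by (auto simp: mat_adjoint_index[OF A] mat_adjoint_index[OF B] mult.commute)
  also have "\<dots> = (mat_adjoint B * mat_adjoint A) $$ (i, j)"
    using C ij by (auto simp: scalar_prod_def atLeast0LessThan)
  finally show "mat_adjoint (A * B) $$ (i, j) = (mat_adjoint B * mat_adjoint A) $$ (i, j)" .
qed

lemma group_unitary_group: "group (unitary_group n)"
proof (rule groupI)
  fix x y assume "x \<in> carrier (unitary_group n)" "y \<in> carrier (unitary_group n)"
  then have x: "x \<in> carrier_mat n n" "mat_adjoint x * x = 1\<^sub>m n" "x * mat_adjoint x = 1\<^sub>m n"
    and y: "y \<in> carrier_mat n n" "mat_adjoint y * y = 1\<^sub>m n" "y * mat_adjoint y = 1\<^sub>m n"
    by (auto simp: unitary_group_def)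
  note ax = mat_adjoint_carrier[OF x(1)] and ay = mat_adjoint_carrier[OF y(1)]
  have "mat_adjoint y * mat_adjoint x * (x * y) = mat_adjoint y * (mat_adjoint x * x * y)"
    using assoc_mult_mat[OF ay ax mult_carrier_mat[OF x(1) y(1)]]
      assoc_mult_mat[OF ax x(1) y(1)] by simp
  moreover have "x * y * (mat_adjoint y * mat_adjoint x) = x * (y * mat_adjoint y * mat_adjoint x)"
    using assoc_mult_mat[OF x(1) y(1) mult_carrier_mat[OF ay ax]]
      assoc_mult_mat[OF y(1) ay ax] by simp
  ultimately show "x \<otimes>\<^bsub>unitary_group n\<^esub> y \<in> carrier (unitary_group n)"
    using x y ax by (auto simp: unitary_group_def mat_adjoint_mult[OF x(1) y(1)])
next
  fix x assume "x \<in> carrier (unitary_group n)"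
  then show "\<exists>y \<in> carrier (unitary_group n). y \<otimes>\<^bsub>unitary_group n\<^esub> x = \<one>\<^bsub>unitary_group n\<^esub>"
    by (intro bexI[of _ "mat_adjoint x"])
      (auto simp: unitary_group_def mat_adjoint_adjoint mat_adjoint_carrier)
qed (auto simp: unitary_group_def mat_adjoint_one)

end

theory Submission
  imports Defs "HOL-Algebra.Weak_Morphisms" "HOL-Analysis.Topology_Euclidean_Space"
begin

text \<open>
  The example is McLain's group over the rationals: the matrices $1 + a$ with rows and columns
  indexed by $\mathbb{Q}$ and $a$ rational, strictly upper triangular with finitely many nonzero
  entries. It is generated by the transvections $t_{ij}(r) = 1 + r e_{ij}$ with $i < j$, and
  $[t_{ik}(r), t_{kj}(s)] = t_{ij}(rs)$ for $i < k < j$. As the index order is dense, the group is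
  perfect. A finite set of elements involves finitely many indices, so it generates a nilpotent group.
  Comparing two matrices at the first entry where they differ (columns in increasing order,
  rows of a column in decreasing order) gives a bi-invariant order, because multiplication by a
  unitriangular matrix does not change that entry of the difference.

  For weak mixing, let $h$ be a homomorphism to $U(n)$, let $z = t_{ij}(r)$ and $g = t_{kj}(1)$ with
  $i < k < j$. For every $m > 0$ conjugation by $t_{ik}(r/m)$ maps $g^m$ to $z g^m$, so
  $h(z) h(g)^m$ and $h(g)^m$ have the same trace. By compactness $h(g)^m$ comes arbitrarily close
  to $1$ for suitable $m > 0$, hence $h(z)$ has trace $n$ and must be $1$.
\<close>

section \<open>McLain groups\<close>

definition supp :: "('i \<Rightarrow> 'i \<Rightarrow> 'a::zero) \<Rightarrow> ('i \<times> 'i) set" where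
  "supp a = {(i, j). a i j \<noteq> 0}"

definition strictly_upper :: "('i::linorder \<Rightarrow> 'i \<Rightarrow> 'a::zero) set" where
  "strictly_upper = {a. finite (supp a) \<and> (\<forall>i j. a i j \<noteq> 0 \<longrightarrow> i < j)}"

text \<open>The matrix $1 + a$ is represented by $a$, so that products become
  $(1 + a)(1 + b) - 1 = a + b + ab$ and the identity becomes $0$.\<close>

definition circ :: "('i \<Rightarrow> 'i \<Rightarrow> 'a::ring_1) \<Rightarrow> ('i \<Rightarrow> 'i \<Rightarrow> 'a) \<Rightarrow> 'i \<Rightarrow> 'i \<Rightarrow> 'a" where
  "circ a b i j = a i j + b i j + (\<Sum>k | a i k \<noteq> 0. a i k * b k j)"

definition mclain :: "('i::linorder \<Rightarrow> 'i \<Rightarrow> 'a::ring_1) monoid" where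
  "mclain = \<lparr>carrier = strictly_upper, monoid.mult = circ, one = \<lambda>_ _. 0\<rparr>"

text \<open>Since 1 + a is represented by a, the transvection 1 + r e_ij appears here without its
  1.\<close>

definition transv :: "'i \<Rightarrow> 'i \<Rightarrow> 'a::zero \<Rightarrow> 'i \<Rightarrow> 'i \<Rightarrow> 'a" where
  "transv i j r = (\<lambda>k l. if k = i \<and> l = j then r else 0)"

lemma mclain_simps [simp]:
  "carrier mclain = strictly_upper" "monoid.mult mclain = circ" "one mclain = (\<lambda>_ _. 0)"
  by (simp_all add: mclain_def)

lemma strictly_upperD:
  assumes "a \<in> strictly_upper"
  shows "finite (supp a)" "a i j \<noteq> 0 \<Longrightarrow> i < j"
  using assms by (auto simp: strictly_upper_def)

lemma finite_row:
  assumes "a \<in> strictly_upper"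
  shows "finite {k. a i k \<noteq> 0}"
proof (rule finite_subset)
  show "{k. a i k \<noteq> 0} \<subseteq> snd ` supp a" by (force simp: supp_def)
qed (use assms in \<open>simp add: strictly_upperD\<close>)

text \<open>The sum in \<open>circ\<close> ranges over a set that depends on \<open>a\<close> and
  the row. Enlarging it to a common finite set \<open>K\<close> only adds zero terms and lets
  several such sums be combined or swapped.\<close>

lemma circ_eq_sum:
  assumes "finite K" "\<And>k. a i k \<noteq> 0 \<Longrightarrow> k \<in> K"
  shows "circ a b i j = a i j + b i j + (\<Sum>k\<in>K. a i k * b k j)"
  unfolding circ_def using assms
  by (intro arg_cong[where f = "(+) _"] sum.mono_neutral_left) auto

lemma circ_zero [simp]: "circ (\<lambda>_ _. 0) a = a" "circ a (\<lambda>_ _. 0) = a"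
  by (simp_all add: circ_def fun_eq_iff)

lemma circ_closed:
  assumes a: "a \<in> strictly_upper" and b: "b \<in> strictly_upper"
  shows "circ a b \<in> strictly_upper"
proof -
  have *: "a i j \<noteq> 0 \<or> b i j \<noteq> 0 \<or> (\<exists>k. a i k \<noteq> 0 \<and> b k j \<noteq> 0)" if "circ a b i j \<noteq> 0" for i j
  proof (rule ccontr)
    assume "\<not> ?thesis"
    then have "circ a b i j = 0" by (auto simp: circ_def intro!: sum.neutral)
    with that show False by simp
  qed
  \<comment> \<open>A nonzero product term puts the row index among the rows of \<open>a\<close> and
    the column index among the columns of \<open>b\<close>.\<close>
  have "supp (circ a b) \<subseteq> supp a \<union> supp b \<union> fst ` supp a \<times> snd ` supp b"
    using * by (force simp: supp_def)
  then have "finite (supp (circ a b))"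
    by (rule finite_subset) (use a b in \<open>auto simp: strictly_upperD\<close>)
  moreover have "i < j" if "circ a b i j \<noteq> 0" for i j
    using *[OF that] strictly_upperD(2)[OF a] strictly_upperD(2)[OF b] by (meson less_trans)
  ultimately show ?thesis by (auto simp: strictly_upper_def)
qed

lemma circ_assoc:
  assumes a: "a \<in> strictly_upper" and b: "b \<in> strictly_upper"
  shows "circ (circ a b) c = circ a (circ b c)"
proof (intro ext)
  fix i j
  \<comment> \<open>\<open>K\<close> collects every column that can occur as a summation index,
    including those of \<open>circ a b\<close>, over which the outer product sums.\<close>
  define K where "K = snd ` supp a \<union> snd ` supp b \<union> snd ` supp (circ a b)"
  have K: "finite K"
    using a b circ_closed[OF a b] by (auto simp: K_def strictly_upperD)
  have aK: "k \<in> K" if "a i k \<noteq> 0" for i k using that by (force simp: K_def supp_def)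
  have bK: "k \<in> K" if "b i k \<noteq> 0" for i k using that by (force simp: K_def supp_def)
  have abK: "k \<in> K" if "circ a b i k \<noteq> 0" for i k using that by (force simp: K_def supp_def)
  have "circ (circ a b) c i j = circ a b i j + c i j + (\<Sum>k\<in>K. circ a b i k * c k j)"
    by (rule circ_eq_sum[OF K abK])
  also have "\<dots> = a i j + b i j + (\<Sum>k\<in>K. a i k * b k j) + c i j
      + ((\<Sum>k\<in>K. a i k * c k j) + (\<Sum>k\<in>K. b i k * c k j) + (\<Sum>k\<in>K. \<Sum>l\<in>K. a i l * b l k * c k j))"
    by (simp add: circ_eq_sum[OF K aK] sum.distrib sum_distrib_right distrib_right)
  also have "(\<Sum>k\<in>K. \<Sum>l\<in>K. a i l * b l k * c k j) = (\<Sum>l\<in>K. \<Sum>k\<in>K. a i l * b l k * c k j)"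
    by (rule sum.swap)
  also have "a i j + b i j + (\<Sum>k\<in>K. a i k * b k j) + c i j
      + ((\<Sum>k\<in>K. a i k * c k j) + (\<Sum>k\<in>K. b i k * c k j) + \<dots>) =
      a i j + circ b c i j + (\<Sum>k\<in>K. a i k * circ b c k j)"
    by (simp add: circ_eq_sum[OF K bK] sum.distrib sum_distrib_left distrib_left mult.assoc)
  also have "\<dots> = circ a (circ b c) i j"
    by (rule circ_eq_sum[OF K aK, symmetric])
  finally show "circ (circ a b) c i j = circ a (circ b c) i j" .
qed

section \<open>Transvections, generation and inverses\<close>

lemma supp_transv: "supp (transv i j r) \<subseteq> {(i, j)}"
  by (auto simp: supp_def transv_def)

lemma transv_closed: "i < j \<Longrightarrow> transv i j r \<in> strictly_upper"
  using finite_subset[OF supp_transv] by (auto simp: strictly_upper_def transv_def)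

text \<open>Left multiplication by a transvection is a row operation: it adds r times row j to row
  i. All identities between transvections reduce to this.\<close>

lemma circ_transv:
  "circ (transv i j r) a k l = transv i j r k l + a k l + (if k = i then r * a j l else 0)"
proof -
  have "circ (transv i j r) a k l =
      transv i j r k l + a k l + (\<Sum>m\<in>{j}. transv i j r k m * a m l)"
    by (rule circ_eq_sum) (auto simp: transv_def split: if_splits)
  then show ?thesis by (auto simp: transv_def)
qed

lemma transv_add: "i \<noteq> j \<Longrightarrow> circ (transv i j r) (transv i j s) = transv i j (r + s)"
  by (auto simp: fun_eq_iff circ_transv) (auto simp: transv_def)

lemma transv_zero: "transv i j 0 = (\<lambda>_ _. 0)"
  by (simp add: transv_def fun_eq_iff)

text \<open>The relation [t_ik(r), t_kj(s)] = t_ij(rs), multiplied out so that no inverses occur and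
  entries can be compared directly.\<close>

lemma transv_commute:
  assumes "i \<noteq> k" "k \<noteq> j" "i \<noteq> j"
  shows "circ (transv i k r) (transv k j s) =
    circ (transv i j (r * s)) (circ (transv k j s) (transv i k r))"
  using assms by (auto simp: fun_eq_iff circ_transv) (auto simp: transv_def)

text \<open>If $j$ is the last nonzero column of $a$ then row $j$ of $a$ vanishes, so multiplying by
  $t_{ij}(-a_{ij})$ on the left only deletes the entry $a_{ij}$.\<close>

lemma strictly_upper_induct [consumes 1, case_names zero transv]:
  fixes a :: "'i::linorder \<Rightarrow> 'i \<Rightarrow> 'a::ring_1"
  assumes "a \<in> strictly_upper" and "P (\<lambda>_ _. 0)"
    and step: "\<And>i j r b. i < j \<Longrightarrow> b \<in> strictly_upper \<Longrightarrow> P b \<Longrightarrow> P (circ (transv i j r) b)"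
  shows "P a"
  using assms(1)
proof (induction "card (supp a)" arbitrary: a rule: less_induct)
  case less
  note a = less.prems
  show ?case
  proof (cases "supp a = {}")
    case True
    then have "a = (\<lambda>_ _. 0)" by (auto simp: supp_def fun_eq_iff)
    with assms(2) show ?thesis by simp
  next
    case False
    note fin = strictly_upperD(1)[OF a]
    define j where "j = Max (snd ` supp a)"
    have "j \<in> snd ` supp a" unfolding j_def using fin False by (intro Max_in) auto
    then obtain i where i: "a i j \<noteq> 0" by (auto simp: supp_def)
    then have ij: "i < j" using a by (simp add: strictly_upperD)
    have row: "a j l = 0" for l
    proof (rule ccontr)
      assume "a j l \<noteq> 0"
      then have "l \<in> snd ` supp a" "j < l" using a by (force simp: supp_def strictly_upperD)+
      then show False using fin by (simp add: j_def leD)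
    qed
    let ?t = "transv i j (a i j)" and ?t' = "transv i j (- a i j)"
    define b where "b = circ ?t' a"
    have b: "b \<in> strictly_upper" unfolding b_def by (intro circ_closed transv_closed ij a)
    have "b = (\<lambda>k l. if k = i \<and> l = j then 0 else a k l)"
      by (auto simp: b_def fun_eq_iff circ_transv row) (auto simp: transv_def)
    then have "supp b \<subset> supp a" using i by (auto simp: supp_def)
    then have "P b" using less.hyps[of b] b fin by (simp add: psubset_card_mono)
    have "circ ?t b = circ (circ ?t ?t') a"
      unfolding b_def by (rule circ_assoc[symmetric]) (intro transv_closed ij)+
    also have "\<dots> = a" using ij by (simp add: transv_add transv_zero)
    finally show ?thesis using step[OF ij b \<open>P b\<close>, of "a i j"] by simp
  qed
qed

text \<open>Left inverses are built along a factorization into transvections: if b inverts a, then b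
  t_ij(-r) inverts t_ij(r) a.\<close>

lemma group_mclain: "group (mclain :: ('i::linorder \<Rightarrow> 'i \<Rightarrow> 'a::ring_1) monoid)"
proof (rule groupI)
  fix a :: "'i \<Rightarrow> 'i \<Rightarrow> 'a"
  assume "a \<in> carrier mclain"
  then have "a \<in> strictly_upper" by simp
  then show "\<exists>b\<in>carrier mclain. b \<otimes>\<^bsub>mclain\<^esub> a = \<one>\<^bsub>mclain\<^esub>"
  proof (induction rule: strictly_upper_induct)
    case zero
    show ?case by (auto simp: strictly_upper_def supp_def)
  next
    case (transv i j r a)
    then obtain b where b: "b \<in> strictly_upper" "circ b a = (\<lambda>_ _. 0)" by auto
    let ?t = "transv i j r" and ?t' = "transv i j (- r)"
    have t: "?t \<in> strictly_upper" "?t' \<in> strictly_upper" using transv by (auto intro: transv_closed)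
    have "circ (circ b ?t') (circ ?t a) = circ b (circ (circ ?t' ?t) a)"
      using b t transv by (simp add: circ_assoc circ_closed)
    also have "\<dots> = (\<lambda>_ _. 0)" using b transv by (simp add: transv_add transv_zero)
    finally show ?case using circ_closed[OF b(1) t(2)] by auto
  qed
qed (auto simp: circ_closed circ_assoc, auto simp: strictly_upper_def supp_def)

section \<open>Cardinality\<close>

lemma countable_strictly_upper:
  "countable (strictly_upper :: ('i::{linorder,countable} \<Rightarrow> 'i \<Rightarrow> 'a::{ring_1,countable}) set)"
proof (rule countable_subset)
  \<comment> \<open>Every element is a finite product of transvections, hence coded by a list of
    triples. Lists with i >= j may leave the group; a countable superset suffices.\<close>
  let ?f = "\<lambda>xs :: ('i \<times> 'i \<times> 'a) list.
    foldr (\<lambda>(i, j, r) b. circ (transv i j r) b) xs (\<lambda>_ _. 0)"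
  show "strictly_upper \<subseteq> range ?f"
  proof
    fix a :: "'i \<Rightarrow> 'i \<Rightarrow> 'a" assume "a \<in> strictly_upper"
    then show "a \<in> range ?f"
    proof (induction rule: strictly_upper_induct)
      case zero
      show ?case by (rule range_eqI[of _ _ "[]"]) simp
    next
      case (transv i j r b)
      then obtain xs where "b = ?f xs" by blast
      then show ?case by (intro range_eqI[of _ _ "(i, j, r) # xs"]) simp
    qed
  qed
qed simp

lemma infinite_strictly_upper:
  fixes i j :: "'i::linorder"
  assumes "i < j"
  shows "infinite (strictly_upper :: ('i \<Rightarrow> 'i \<Rightarrow> 'a::ring_char_0) set)"
proof
  assume "finite (strictly_upper :: ('i \<Rightarrow> 'i \<Rightarrow> 'a) set)"
  moreover have "range (\<lambda>n. transv i j (of_nat n) :: 'i \<Rightarrow> 'i \<Rightarrow> 'a) \<subseteq> strictly_upper"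
    using transv_closed[OF assms] by auto
  moreover have "inj (\<lambda>n. transv i j (of_nat n) :: 'i \<Rightarrow> 'i \<Rightarrow> 'a)"
    by (auto simp: inj_def transv_def fun_eq_iff)
  ultimately show False using finite_subset range_inj_infinite by blast
qed

section \<open>Perfectness and order\<close>

lemma perfect_mclain:
  "perfect (mclain :: ('i::dense_linorder \<Rightarrow> 'i \<Rightarrow> 'a::ring_1) monoid)"
proof -
  let ?G = "mclain :: ('i \<Rightarrow> 'i \<Rightarrow> 'a) monoid"
  interpret group ?G by (rule group_mclain)
  interpret D: subgroup "derived ?G (carrier ?G)" ?G
    by (rule derived_is_subgroup) simp
  have "a \<in> derived ?G (carrier ?G)" if "a \<in> strictly_upper" for a :: "'i \<Rightarrow> 'i \<Rightarrow> 'a"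
    using that
  proof (induction rule: strictly_upper_induct)
    case zero
    show ?case using D.one_closed by simp
  next
    case (transv i j r b)
    obtain k where k: "i < k" "k < j" using dense[OF \<open>i < j\<close>] by blast
    let ?x = "transv i k r" and ?y = "transv k j (1 :: 'a)" and ?z = "transv i j r"
    have c: "?x \<in> carrier ?G" "?y \<in> carrier ?G" "?z \<in> carrier ?G"
      using k \<open>i < j\<close> by (auto intro: transv_closed)
    have "?x \<otimes>\<^bsub>?G\<^esub> ?y = ?z \<otimes>\<^bsub>?G\<^esub> (?y \<otimes>\<^bsub>?G\<^esub> ?x)"
      using transv_commute[of i k j r 1] k by auto
    \<comment> \<open>Solving the relation for \<open>?z\<close> gives the commutator in the shape
      used by \<open>derived\<close>.\<close>
    then have "?z = ?x \<otimes>\<^bsub>?G\<^esub> ?y \<otimes>\<^bsub>?G\<^esub> inv\<^bsub>?G\<^esub> (?y \<otimes>\<^bsub>?G\<^esub> ?x)"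
      using c by (metis inv_solve_right m_closed)
    also have "\<dots> = ?x \<otimes>\<^bsub>?G\<^esub> ?y \<otimes>\<^bsub>?G\<^esub> inv\<^bsub>?G\<^esub> ?x \<otimes>\<^bsub>?G\<^esub> inv\<^bsub>?G\<^esub> ?y"
      using c by (metis inv_closed inv_mult_group m_assoc m_closed)
    finally have "?z \<in> derived ?G (carrier ?G)"
      unfolding derived_def using c by (intro generate.incl) blast
    from D.m_closed[OF this transv.IH] show ?case by simp
  qed
  then show ?thesis
    using derived_in_carrier[of "carrier ?G"] by (auto simp: perfect_def)
qed

section \<open>The bi-invariant order\<close>

definition lex_less :: "('i::linorder \<Rightarrow> 'i \<Rightarrow> 'a::ord) \<Rightarrow> ('i \<Rightarrow> 'i \<Rightarrow> 'a) \<Rightarrow> bool" where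
  "lex_less a b \<longleftrightarrow>
     (\<exists>i j. a i j < b i j \<and> (\<forall>k l. l < j \<or> l = j \<and> i < k \<longrightarrow> a k l = b k l))"

lemma lex_less_irrefl: "\<not> lex_less a (a :: 'i::linorder \<Rightarrow> 'i \<Rightarrow> 'a::order)"
  by (simp add: lex_less_def)

text \<open>The earlier of the two deciding positions decides between \<open>a\<close> and
  \<open>c\<close>; if they coincide, the two inequalities chain.\<close>

lemma lex_less_trans:
  fixes a b c :: "'i::linorder \<Rightarrow> 'i \<Rightarrow> 'a::order"
  assumes "lex_less a b" "lex_less b c"
  shows "lex_less a c"
proof -
  obtain i j where ij: "a i j < b i j" "\<And>k l. l < j \<or> l = j \<and> i < k \<Longrightarrow> a k l = b k l"
    using assms(1) unfolding lex_less_def by blast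
  obtain i' j' where ij': "b i' j' < c i' j'" "\<And>k l. l < j' \<or> l = j' \<and> i' < k \<Longrightarrow> b k l = c k l"
    using assms(2) unfolding lex_less_def by blast
  consider "j < j' \<or> j = j' \<and> i' < i" | "j = j'" "i = i'" | "j' < j \<or> j = j' \<and> i < i'"
    by (meson linorder_neqE)
  then show ?thesis
  proof cases
    case 1
    then have "a i j < c i j" using ij(1) ij'(2)[of j i] by auto
    moreover have "a k l = c k l" if "l < j \<or> l = j \<and> i < k" for k l
      using ij(2)[OF that] ij'(2)[of l k] 1 that by force
    ultimately show ?thesis unfolding lex_less_def by blast
  next
    case 2
    then have "a i j < c i j" using ij(1) ij'(1) by auto
    moreover have "a k l = c k l" if "l < j \<or> l = j \<and> i < k" for k l
      using ij(2)[OF that] ij'(2)[of l k] 2 that by force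
    ultimately show ?thesis unfolding lex_less_def by blast
  next
    case 3
    then have "a i' j' < c i' j'" using ij'(1) ij(2)[of j' i'] by auto
    moreover have "a k l = c k l" if "l < j' \<or> l = j' \<and> i' < k" for k l
      using ij'(2)[OF that] ij(2)[of l k] 3 that by force
    ultimately show ?thesis unfolding lex_less_def by blast
  qed
qed

text \<open>Only finitely many entries differ, so there is a first differing position: the least
  column, and in it the greatest row.\<close>

lemma lex_less_total:
  fixes a b :: "'i::linorder \<Rightarrow> 'i \<Rightarrow> 'a::{linorder,zero}"
  assumes "a \<in> strictly_upper" "b \<in> strictly_upper" "a \<noteq> b"
  shows "lex_less a b \<or> lex_less b a"
proof -
  define S where "S = {(i, j). a i j \<noteq> b i j}"
  have "S \<subseteq> supp a \<union> supp b" by (auto simp: S_def supp_def)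
  then have fin: "finite S"
    by (rule finite_subset) (use assms in \<open>auto simp: strictly_upperD\<close>)
  have "S \<noteq> {}" using assms(3) by (auto simp: S_def fun_eq_iff)
  define j where "j = Min (snd ` S)"
  define R where "R = {i. (i, j) \<in> S}"
  have "j \<in> snd ` S" unfolding j_def using fin \<open>S \<noteq> {}\<close> by (intro Min_in) auto
  then have "R \<noteq> {}" by (auto simp: R_def)
  have "R \<subseteq> fst ` S" by (force simp: R_def)
  then have finR: "finite R" by (rule finite_subset) (use fin in simp)
  define i where "i = Max R"
  have "i \<in> R" unfolding i_def by (rule Max_in[OF finR \<open>R \<noteq> {}\<close>])
  then have ne: "a i j \<noteq> b i j" by (simp add: R_def S_def)
  have eq: "a k l = b k l" if "l < j \<or> l = j \<and> i < k" for k l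
  proof (rule ccontr)
    assume "a k l \<noteq> b k l"
    then have kl: "(k, l) \<in> S" by (simp add: S_def)
    then have "l \<in> snd ` S" by force
    then have "j \<le> l" unfolding j_def by (intro Min_le) (use fin in auto)
    with that have "l = j" "i < k" by auto
    with kl have "k \<in> R" by (simp add: R_def)
    then have "k \<le> i" unfolding i_def by (rule Max_ge[OF finR])
    with \<open>i < k\<close> show False by simp
  qed
  from ne consider "a i j < b i j" | "b i j < a i j" by (meson linorder_neqE)
  then show ?thesis
  proof cases
    case 1
    with eq show ?thesis unfolding lex_less_def by blast
  next
    case 2
    with eq show ?thesis unfolding lex_less_def by metis
  qed
qed

lemma lex_less_circ_left:
  fixes a b c :: "'i::linorder \<Rightarrow> 'i \<Rightarrow> 'a::linordered_idom"
  assumes a: "a \<in> strictly_upper" and b: "b \<in> strictly_upper" and c: "c \<in> strictly_upper"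
    and "lex_less a b"
  shows "lex_less (circ c a) (circ c b)"
proof -
  obtain i j where ij: "a i j < b i j" "\<And>k l. l < j \<or> l = j \<and> i < k \<Longrightarrow> a k l = b k l"
    using assms(4) unfolding lex_less_def by blast
  \<comment> \<open>Row k of c only brings in rows m > k, and there \<open>a\<close> and
    \<open>b\<close> agree in column l. This is why rows are compared in decreasing order. The range
    includes the deciding position itself.\<close>
  have *: "circ c b k l - circ c a k l = b k l - a k l" if "l < j \<or> l = j \<and> i \<le> k" for k l
  proof -
    have "c k m * a m l = c k m * b m l" if "c k m \<noteq> 0" for m
    proof -
      have "k < m" using c that by (simp add: strictly_upperD)
      then have "a m l = b m l" using \<open>l < j \<or> l = j \<and> i \<le> k\<close> by (intro ij(2)) auto
      then show ?thesis by simp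
    qed
    then show ?thesis by (simp add: circ_def)
  qed
  have "circ c a i j < circ c b i j" using *[of j i] ij(1) by (simp add: algebra_simps)
  moreover have "circ c a k l = circ c b k l" if "l < j \<or> l = j \<and> i < k" for k l
    using *[of l k] ij(2)[OF that] that by auto
  ultimately show ?thesis unfolding lex_less_def by blast
qed

lemma lex_less_circ_right:
  fixes a b c :: "'i::linorder \<Rightarrow> 'i \<Rightarrow> 'a::linordered_idom"
  assumes a: "a \<in> strictly_upper" and b: "b \<in> strictly_upper" and c: "c \<in> strictly_upper"
    and "lex_less a b"
  shows "lex_less (circ a c) (circ b c)"
proof -
  obtain i j where ij: "a i j < b i j" "\<And>k l. l < j \<or> l = j \<and> i < k \<Longrightarrow> a k l = b k l"
    using assms(4) unfolding lex_less_def by blast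
  \<comment> \<open>Column l of c only brings in columns m < l, which lie strictly before j, where
    \<open>a\<close> and \<open>b\<close> agree. \<open>?K\<close> gives both products the same
    range of summation.\<close>
  have *: "circ b c k l - circ a c k l = b k l - a k l" if "l \<le> j" for k l
  proof -
    let ?K = "{m. a k m \<noteq> 0} \<union> {m. b k m \<noteq> 0}"
    have K: "finite ?K" using a b by (simp add: finite_row)
    have "a k m * c m l = b k m * c m l" for m
    proof (cases "c m l = 0")
      case False
      then have "m < l" using c by (simp add: strictly_upperD)
      then have "a k m = b k m" using \<open>l \<le> j\<close> by (intro ij(2)) auto
      then show ?thesis by simp
    qed simp
    then have "(\<Sum>m\<in>?K. a k m * c m l) = (\<Sum>m\<in>?K. b k m * c m l)"
      by (rule sum.cong[OF refl])
    then show ?thesis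
      using circ_eq_sum[OF K, of a k c l] circ_eq_sum[OF K, of b k c l] by simp
  qed
  have "circ a c i j < circ b c i j" using *[of j i] ij(1) by (simp add: algebra_simps)
  moreover have "circ a c k l = circ b c k l" if "l < j \<or> l = j \<and> i < k" for k l
    using *[of l k] ij(2)[OF that] that by auto
  ultimately show ?thesis unfolding lex_less_def by blast
qed

lemma orderable_mclain:
  "orderable (mclain :: ('i::linorder \<Rightarrow> 'i \<Rightarrow> 'a::linordered_idom) monoid)"
proof -
  let ?U = "strictly_upper :: ('i \<Rightarrow> 'i \<Rightarrow> 'a) set"
  define r where "r = {(a, b). a \<in> ?U \<and> b \<in> ?U \<and> (a = b \<or> lex_less a b)}"
  have "linear_order_on ?U r"
    unfolding order_on_defs
  proof (intro conjI)
    show "trans r" by (rule transI) (auto simp: r_def intro: lex_less_trans)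
    show "antisym r"
      using lex_less_trans lex_less_irrefl by (intro antisymI) (auto simp: r_def)
    show "total_on ?U r" using lex_less_total by (auto simp: total_on_def r_def)
  qed (auto simp: r_def refl_on_def)
  then show ?thesis
    unfolding orderable_def
    by (intro exI[of _ r])
      (auto simp: r_def circ_closed lex_less_circ_left lex_less_circ_right)
qed

section \<open>Local solvability\<close>

text \<open>A term of the lower central filtration of the unitriangular group on a finite set $F$ of
  indices: entries of positions at distance at most $n$ in $F$ vanish.\<close>

definition sep :: "'i::linorder set \<Rightarrow> nat \<Rightarrow> ('i \<Rightarrow> 'i \<Rightarrow> 'a::zero) set" where
  "sep F n = {a \<in> strictly_upper.
     supp a \<subseteq> F \<times> F \<and> (\<forall>i j. card (F \<inter> {i<..j}) \<le> n \<longrightarrow> a i j = 0)}"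

lemma sepD:
  assumes "a \<in> sep F n"
  shows "a \<in> strictly_upper" "a i j \<noteq> 0 \<Longrightarrow> i \<in> F" "a i j \<noteq> 0 \<Longrightarrow> j \<in> F"
    "a i j \<noteq> 0 \<Longrightarrow> n < card (F \<inter> {i<..j})" "card (F \<inter> {i<..j}) \<le> n \<Longrightarrow> a i j = 0"
  using assms by (fastforce simp: sep_def supp_def not_less)+

lemma sepI:
  assumes "a \<in> strictly_upper" "\<And>i j. a i j \<noteq> 0 \<Longrightarrow> i \<in> F \<and> j \<in> F"
    "\<And>i j. card (F \<inter> {i<..j}) \<le> n \<Longrightarrow> a i j = 0"
  shows "a \<in> sep F n"
  using assms by (auto simp: sep_def supp_def)

text \<open>A nonzero entry at (i, j) has i < j and j in \<open>F\<close>, so j itself lies in the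
  interval that is counted. At level 0 the vanishing condition thus follows from the
  support.\<close>

lemma sep_0:
  assumes "finite F"
  shows "sep F 0 = {a \<in> strictly_upper. supp a \<subseteq> F \<times> F}"
proof -
  have "a i j = 0" if "a \<in> strictly_upper" "supp a \<subseteq> F \<times> F" "card (F \<inter> {i<..j}) = 0"
    for a :: "'a \<Rightarrow> 'a \<Rightarrow> 'b" and i j
  proof (rule ccontr)
    assume "a i j \<noteq> 0"
    then have "j \<in> F \<inter> {i<..j}" using that by (auto simp: supp_def strictly_upperD)
    then show False using that(3) assms by auto
  qed
  then show ?thesis by (auto simp: sep_def)
qed

text \<open>No interval contains more than \<open>card F\<close> points of \<open>F\<close>, so the
  filtration ends here.\<close>

lemma sep_card:
  assumes "finite F"
  shows "sep F (card F) \<subseteq> {\<lambda>_ _. 0}"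
  using assms by (auto simp: fun_eq_iff intro!: sepD(5) card_mono)

text \<open>A nonzero term needs i < k < j with k and j in \<open>F\<close>, so both (i, k] and (k,
  j] contain fewer points of \<open>F\<close> than (i, j]. Having more than m and n points, they
  force at least max m n + 2 points in (i, j]. Up to distance max m n + 1 the group operation is
  therefore plain addition of entries.\<close>

lemma sep_sum_eq_0:
  fixes a b :: "'i::linorder \<Rightarrow> 'i \<Rightarrow> 'a::ring_1"
  assumes "finite F" and a: "a \<in> sep F m" and b: "b \<in> sep F n"
    and d: "card (F \<inter> {i<..j}) \<le> Suc (max m n)"
  shows "circ a b i j = a i j + b i j"
proof -
  have "a i k * b k j = 0" for k
  proof (rule ccontr)
    assume "a i k * b k j \<noteq> 0"
    then have nz: "a i k \<noteq> 0" "b k j \<noteq> 0" by auto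
    then have less: "i < k" "k < j" using sepD(1)[OF a] sepD(1)[OF b] by (auto simp: strictly_upperD)
    have kF: "k \<in> F" "j \<in> F" using sepD(3)[OF a nz(1)] sepD(3)[OF b nz(2)] by auto
    have "j \<in> F \<inter> {i<..j} - F \<inter> {i<..k}" "F \<inter> {i<..k} \<subseteq> F \<inter> {i<..j}"
      using less kF by auto
    then have "F \<inter> {i<..k} \<subset> F \<inter> {i<..j}" by blast
    then have "card (F \<inter> {i<..k}) < card (F \<inter> {i<..j})"
      using \<open>finite F\<close> by (intro psubset_card_mono) auto
    moreover have "k \<in> F \<inter> {i<..j} - F \<inter> {k<..j}" "F \<inter> {k<..j} \<subseteq> F \<inter> {i<..j}"
      using less kF by auto
    then have "F \<inter> {k<..j} \<subset> F \<inter> {i<..j}" by blast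
    then have "card (F \<inter> {k<..j}) < card (F \<inter> {i<..j})"
      using \<open>finite F\<close> by (intro psubset_card_mono) auto
    ultimately show False using d sepD(4)[OF a nz(1)] sepD(4)[OF b nz(2)] by auto
  qed
  then show ?thesis by (simp add: circ_def)
qed

lemma circ_sep:
  fixes a b :: "'i::linorder \<Rightarrow> 'i \<Rightarrow> 'a::ring_1"
  assumes "finite F" and a: "a \<in> sep F n" and b: "b \<in> sep F n"
  shows "circ a b \<in> sep F n"
proof (rule sepI)
  show "circ a b \<in> strictly_upper" using sepD(1)[OF a] sepD(1)[OF b] by (rule circ_closed)
  show "i \<in> F \<and> j \<in> F" if "circ a b i j \<noteq> 0" for i j
  proof (rule ccontr)
    assume "\<not> (i \<in> F \<and> j \<in> F)"
    then have "a i j = 0" "b i j = 0" "\<And>k. a i k * b k j = 0"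
      using sepD(2,3)[OF a] sepD(2,3)[OF b] by (metis mult_zero_left mult_zero_right)+
    then show False using that by (simp add: circ_def)
  qed
  show "circ a b i j = 0" if "card (F \<inter> {i<..j}) \<le> n" for i j
    using sep_sum_eq_0[OF \<open>finite F\<close> a b, of i j] sepD(5)[OF a that] sepD(5)[OF b that] that by simp
qed

text \<open>Outside \<open>F\<close> the rows of \<open>a\<close> vanish, so those of ab are the
  rows of \<open>b\<close>; likewise for columns and ba. Hence \<open>b\<close> is supported on
  \<open>F\<close>, and at distance at most n additivity turns ab = 0 into b = -a = 0
  entrywise.\<close>

lemma inv_sep:
  fixes a b :: "'i::linorder \<Rightarrow> 'i \<Rightarrow> 'a::ring_1"
  assumes "finite F" and a: "a \<in> sep F n" and b: "b \<in> strictly_upper"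
    and ab: "circ a b = (\<lambda>_ _. 0)" and ba: "circ b a = (\<lambda>_ _. 0)"
  shows "b \<in> sep F n"
proof -
  have F: "i \<in> F \<and> j \<in> F" if "b i j \<noteq> 0" for i j
  proof
    show "i \<in> F"
    proof (rule ccontr)
      assume "i \<notin> F"
      then have "a i k = 0" for k using sepD(2)[OF a] by blast
      then have "circ a b i j = b i j" by (simp add: circ_def)
      with ab that show False by simp
    qed
    show "j \<in> F"
    proof (rule ccontr)
      assume "j \<notin> F"
      then have "a k j = 0" for k using sepD(3)[OF a] by blast
      then have "circ b a i j = b i j" by (simp add: circ_def)
      with ba that show False by simp
    qed
  qed
  then have b0: "b \<in> sep F 0"
    unfolding sep_0[OF \<open>finite F\<close>] using b by (auto simp: supp_def)
  show ?thesis
  proof (rule sepI)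
    show "b i j = 0" if "card (F \<inter> {i<..j}) \<le> n" for i j
      using sep_sum_eq_0[OF \<open>finite F\<close> a b0, of i j] sepD(5)[OF a that] ab that by simp
  qed (use b F in auto)
qed

lemma subgroup_sep:
  assumes "finite F"
  shows "subgroup (sep F n) (mclain :: ('i::linorder \<Rightarrow> 'i \<Rightarrow> 'a::ring_1) monoid)"
proof -
  let ?G = "mclain :: ('i \<Rightarrow> 'i \<Rightarrow> 'a) monoid"
  interpret group ?G by (rule group_mclain)
  show ?thesis
  proof (rule subgroupI)
    have "(\<lambda>_ _. 0) \<in> (sep F n :: ('i \<Rightarrow> 'i \<Rightarrow> 'a) set)"
      by (rule sepI) (auto simp: strictly_upper_def supp_def)
    then show "sep F n \<noteq> ({} :: ('i \<Rightarrow> 'i \<Rightarrow> 'a) set)" by blast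
    show "inv\<^bsub>?G\<^esub> a \<in> sep F n" if "a \<in> sep F n" for a
    proof (rule inv_sep[OF assms that])
      have "a \<in> carrier ?G" using sepD(1)[OF that] by simp
      then show "inv\<^bsub>?G\<^esub> a \<in> strictly_upper" "circ a (inv\<^bsub>?G\<^esub> a) = (\<lambda>_ _. 0)"
        "circ (inv\<^bsub>?G\<^esub> a) a = (\<lambda>_ _. 0)"
        using inv_closed[of a] r_inv[of a] l_inv[of a] by simp_all
    qed
  next
    show "sep F n \<subseteq> carrier ?G" using sepD(1) by auto
    show "a \<otimes>\<^bsub>?G\<^esub> b \<in> sep F n" if "a \<in> sep F n" "b \<in> sep F n" for a b
      using circ_sep[OF assms that] by simp
  qed
qed

text \<open>For a commutator c of x and y, c(yx) = xy. At distance at most n + 1 both sides are sums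
  of entries, so c + y + x = x + y and the entry of c vanishes.\<close>

lemma derived_sep:
  assumes "finite F"
  shows "derived mclain (sep F n) \<subseteq> (sep F (Suc n) :: ('i::linorder \<Rightarrow> 'i \<Rightarrow> 'a::ring_1) set)"
proof -
  let ?G = "mclain :: ('i \<Rightarrow> 'i \<Rightarrow> 'a) monoid"
  interpret group ?G by (rule group_mclain)
  interpret S: subgroup "sep F n" ?G by (rule subgroup_sep[OF assms])
  have "x \<otimes>\<^bsub>?G\<^esub> y \<otimes>\<^bsub>?G\<^esub> inv\<^bsub>?G\<^esub> x \<otimes>\<^bsub>?G\<^esub> inv\<^bsub>?G\<^esub> y \<in> sep F (Suc n)"
    if x: "x \<in> sep F n" and y: "y \<in> sep F n" for x y
  proof -
    define c where "c = x \<otimes>\<^bsub>?G\<^esub> y \<otimes>\<^bsub>?G\<^esub> inv\<^bsub>?G\<^esub> x \<otimes>\<^bsub>?G\<^esub> inv\<^bsub>?G\<^esub> y"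
    have c: "c \<in> sep F n" unfolding c_def
      by (intro S.m_closed S.m_inv_closed x y)
    have "c \<otimes>\<^bsub>?G\<^esub> (y \<otimes>\<^bsub>?G\<^esub> x) = x \<otimes>\<^bsub>?G\<^esub> y"
      using S.mem_carrier[OF x] S.mem_carrier[OF y] unfolding c_def
      by (metis inv_closed inv_solve_right m_assoc m_closed)
    then have eq: "circ c (circ y x) = circ x y" by simp
    have "c \<in> sep F (Suc n)"
    proof (rule sepI)
      show "c i j = 0" if "card (F \<inter> {i<..j}) \<le> Suc n" for i j
        using sep_sum_eq_0[OF assms c circ_sep[OF assms y x], of i j]
          sep_sum_eq_0[OF assms x y, of i j] sep_sum_eq_0[OF assms y x, of i j] eq that
        by simp
    qed (use sepD(1-3)[OF c] in auto)
    then show ?thesis unfolding c_def .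
  qed
  then show ?thesis
    unfolding derived_def
    by (intro generate_subgroup_incl[OF _ subgroup_sep[OF assms]]) blast
qed

text \<open>Passes from a solvable series inside \<open>G\<close> to solvability of \<open>H\<close>
  as a group of its own, by pulling back along the inclusion.\<close>

lemma solvable_seq_imp_solvable:
  assumes "group G" "subgroup H G" "solvable_seq G H"
  shows "solvable (G\<lparr>carrier := H\<rparr>)"
proof -
  interpret group_hom "G\<lparr>carrier := H\<rparr>" G id
    using assms by (auto simp: group_hom_def group_hom_axioms_def hom_def subgroup.subgroup_is_group
        dest: subgroup.mem_carrier)
  show ?thesis
    using solvable_img_imp_solvable[OF G.subgroup_self] assms(3) by (simp add: solvable_def)
qed

lemma locally_solvable_mclain:
  "locally_solvable (mclain :: ('i::linorder \<Rightarrow> 'i \<Rightarrow> 'a::ring_1) monoid)"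
proof -
  let ?G = "mclain :: ('i \<Rightarrow> 'i \<Rightarrow> 'a) monoid"
  interpret group ?G by (rule group_mclain)
  show ?thesis
    unfolding locally_solvable_def
  proof (intro allI impI)
    fix S assume S: "S \<subseteq> carrier ?G" "finite S"
    define F where "F = (\<Union>a\<in>S. fst ` supp a \<union> snd ` supp a)"
    have "finite F" using S by (auto simp: F_def strictly_upperD subset_iff)
    have "S \<subseteq> sep F 0"
      unfolding sep_0[OF \<open>finite F\<close>] using S(1) by (force simp: F_def)
    then have sub: "generate ?G S \<subseteq> sep F 0"
      by (rule generate_subgroup_incl[OF _ subgroup_sep[OF \<open>finite F\<close>]])
    have sg: "subgroup (generate ?G S) ?G" by (rule generate_is_subgroup[OF S(1)])
    \<comment> \<open>The derived series descends at least as fast as the filtration, so it is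
      trivial after \<open>card F\<close> steps.\<close>
    have der: "(derived ?G ^^ n) (generate ?G S) \<subseteq> sep F n" for n
    proof (induction n)
      case (Suc n)
      have "(derived ?G ^^ Suc n) (generate ?G S) \<subseteq> derived ?G (sep F n)"
        using mono_derived[OF Suc.IH] by simp
      also have "\<dots> \<subseteq> sep F (Suc n)" by (rule derived_sep[OF \<open>finite F\<close>])
      finally show ?case .
    qed (use sub in simp)
    have "(derived ?G ^^ card F) (generate ?G S) \<subseteq> {\<one>\<^bsub>?G\<^esub>}"
      using subset_trans[OF der sep_card[OF \<open>finite F\<close>]] by simp
    then have "(derived ?G ^^ card F) (generate ?G S) = {\<one>\<^bsub>?G\<^esub>}"
      using subgroup.one_closed[OF exp_of_derived_is_subgroup[OF sg]] by blast
    then show "solvable (?G\<lparr>carrier := generate ?G S\<rparr>)"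
      using trivial_derived_seq_imp_solvable[OF sg] solvable_seq_imp_solvable[OF is_group sg] by blast
  qed
qed

section \<open>Weak mixing\<close>

lemma unitary_groupD:
  assumes "U \<in> carrier (unitary_group n)"
  shows "U \<in> carrier_mat n n" "dim_row U = n" "dim_col U = n"
  using assms by (auto simp: unitary_group_def)

lemma mult_adjoint_index:
  assumes A: "A \<in> carrier_mat n n" and B: "B \<in> carrier_mat n n" and "i < n" "j < n"
  shows "(A * mat_adjoint B) $$ (i, j) = (\<Sum>l<n. A $$ (i, l) * cnj (B $$ (j, l)))"
proof -
  have "(A * mat_adjoint B) $$ (i, j) = (\<Sum>l<n. A $$ (i, l) * mat_adjoint B $$ (l, j))"
    using mat_adjoint_carrier[OF B] assms by (auto simp: scalar_prod_def atLeast0LessThan)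
  then show ?thesis using assms by (simp add: mat_adjoint_index[OF B])
qed

lemma unitary_rows:
  assumes "U \<in> carrier (unitary_group n)" "i < n" "j < n"
  shows "(\<Sum>l<n. U $$ (i, l) * cnj (U $$ (j, l))) = (if i = j then 1 else 0)"
  using assms mult_adjoint_index[of U n U i j] by (auto simp: unitary_group_def)

lemma unitary_row_norm:
  assumes "U \<in> carrier (unitary_group n)" "i < n"
  shows "(\<Sum>l<n. (cmod (U $$ (i, l)))\<^sup>2) = 1"
proof -
  have "complex_of_real (\<Sum>l<n. (cmod (U $$ (i, l)))\<^sup>2) = 1"
    using unitary_rows[OF assms assms(2)] by (simp add: complex_norm_square del: of_real_power)
  then show ?thesis by (simp only: of_real_eq_1_iff)
qed

lemma unitary_entry_le_1:
  assumes "U \<in> carrier (unitary_group n)" "i < n" "j < n"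
  shows "cmod (U $$ (i, j)) \<le> 1"
proof -
  have "(cmod (U $$ (i, j)))\<^sup>2 \<le> (\<Sum>l<n. (cmod (U $$ (i, l)))\<^sup>2)"
    using assms by (intro member_le_sum) auto
  then show ?thesis using unitary_row_norm[OF assms(1,2)] by (simp add: abs_square_le_1)
qed

text \<open>Diagonal entries have real part at most 1, so trace n forces every real part to be 1. As
  each row has norm 1, nothing is left for the imaginary parts or the other entries.\<close>

lemma unitary_trace_eq_imp_one:
  assumes U: "U \<in> carrier (unitary_group n)" and tr: "(\<Sum>i<n. U $$ (i, i)) = of_nat n"
  shows "U = 1\<^sub>m n"
proof -
  have le: "Re (U $$ (i, i)) \<le> 1" if "i < n" for i
    using unitary_entry_le_1[OF U that that] complex_Re_le_cmod order_trans by blast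
  have "(\<Sum>i<n. 1 - Re (U $$ (i, i))) = 0"
    using arg_cong[OF tr, of Re] by (simp add: sum_subtractf)
  then have re: "Re (U $$ (i, i)) = 1" if "i < n" for i
    using le that by (subst (asm) sum_nonneg_eq_0_iff) auto
  have off: "U $$ (i, j) = (if i = j then 1 else 0)" if ij: "i < n" "j < n" for i j
  proof -
    have "1 \<le> cmod (U $$ (i, i))" using re[OF ij(1)] complex_Re_le_cmod[of "U $$ (i, i)"] by simp
    then have one: "cmod (U $$ (i, i)) = 1"
      using unitary_entry_le_1[OF U ij(1) ij(1)] by simp
    show ?thesis
    proof (cases "i = j")
      case True
      have "(Im (U $$ (i, i)))\<^sup>2 = 0"
        using one re[OF ij(1)] by (simp add: cmod_def)
      then show ?thesis using True re[OF ij(1)] by (simp add: complex_eq_iff)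
    next
      case False
      have "(\<Sum>l<n. (cmod (U $$ (i, l)))\<^sup>2) =
          (cmod (U $$ (i, i)))\<^sup>2 + (\<Sum>l\<in>{..<n} - {i}. (cmod (U $$ (i, l)))\<^sup>2)"
        using ij by (intro sum.remove) auto
      then have "(\<Sum>l\<in>{..<n} - {i}. (cmod (U $$ (i, l)))\<^sup>2) = 0"
        using unitary_row_norm[OF U ij(1)] one by simp
      then have "(cmod (U $$ (i, j)))\<^sup>2 = 0"
        using False ij by (subst (asm) sum_nonneg_eq_0_iff) auto
      then show ?thesis using False by simp
    qed
  qed
  show ?thesis using unitary_groupD[OF U] off by (intro eq_matI) auto
qed

section \<open>Compactness and recurrence of powers\<close>

text \<open>Bolzano-Weierstrass applied to one index after another. With matrix positions as indices
  it supplies the compactness of U(n) entrywise.\<close>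

lemma bounded_family_convergent_subsequence:
  fixes f :: "nat \<Rightarrow> 'b \<Rightarrow> 'a::heine_borel"
  assumes "finite I" "\<And>i. i \<in> I \<Longrightarrow> bounded (range (\<lambda>k. f k i))"
  shows "\<exists>l r. strict_mono (r :: nat \<Rightarrow> nat) \<and> (\<forall>i\<in>I. (\<lambda>k. f (r k) i) \<longlonglongrightarrow> l i)"
  using assms
proof (induction I rule: finite_induct)
  case empty
  show ?case using strict_mono_id by auto
next
  case (insert i I)
  then obtain l r where r: "strict_mono (r :: nat \<Rightarrow> nat)" "\<forall>i\<in>I. (\<lambda>k. f (r k) i) \<longlonglongrightarrow> l i"
    by auto
  have "range (\<lambda>k. f (r k) i) \<subseteq> range (\<lambda>k. f k i)" by auto
  then have "bounded (range (\<lambda>k. f (r k) i))" using insert.prems bounded_subset by blast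
  then obtain m s where s: "strict_mono (s :: nat \<Rightarrow> nat)" "((\<lambda>k. f (r k) i) \<circ> s) \<longlonglongrightarrow> m"
    using bounded_imp_convergent_subsequence by blast
  have "(\<lambda>k. f (r (s k)) j) \<longlonglongrightarrow> (l(i := m)) j" if "j \<in> insert i I" for j
  proof (cases "j = i")
    case True
    then show ?thesis using s(2) by (simp add: o_def)
  next
    case False
    then have "(\<lambda>k. f (r k) j) \<longlonglongrightarrow> l j" using that r(2) by blast
    from LIMSEQ_subseq_LIMSEQ[OF this s(1)] False show ?thesis by (simp add: o_def)
  qed
  then show ?case using strict_mono_o[OF r(1) s(1)]
    by (intro exI[of _ "l(i := m)"] exI[of _ "r \<circ> s"]) (simp add: o_def)
qed

lemma sum_diag_mult_commute:
  fixes A B :: "'a::comm_semiring_0 mat"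
  assumes "A \<in> carrier_mat n n" "B \<in> carrier_mat n n"
  shows "(\<Sum>i<n. (A * B) $$ (i, i)) = (\<Sum>i<n. (B * A) $$ (i, i))"
proof -
  have "(\<Sum>i<n. (A * B) $$ (i, i)) = (\<Sum>i<n. \<Sum>j<n. A $$ (i, j) * B $$ (j, i))"
    using assms by (auto simp: scalar_prod_def atLeast0LessThan)
  also have "\<dots> = (\<Sum>j<n. \<Sum>i<n. A $$ (i, j) * B $$ (j, i))" by (rule sum.swap)
  also have "\<dots> = (\<Sum>i<n. (B * A) $$ (i, i))"
    using assms by (auto simp: scalar_prod_def atLeast0LessThan mult.commute)
  finally show ?thesis .
qed

text \<open>If the powers with exponents r k converge to L, then those with exponents r (k + 1) - r
  k are quotients of consecutive terms and converge to L L* = 1.\<close>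

lemma unitary_powers_recurrent:
  assumes U: "U \<in> carrier (unitary_group n)"
  shows "\<exists>m :: nat \<Rightarrow> nat. (\<forall>k. m k > 0) \<and> (\<forall>i<n. \<forall>j<n.
    (\<lambda>k. (U [^]\<^bsub>unitary_group n\<^esub> m k) $$ (i, j)) \<longlonglongrightarrow> (if i = j then 1 else 0))"
proof -
  let ?U = "unitary_group n"
  interpret group ?U by (rule group_unitary_group)
  define Y where "Y = (\<lambda>k :: nat. U [^]\<^bsub>?U\<^esub> k)"
  have Y: "Y k \<in> carrier ?U" for k using U by (simp add: Y_def)
  note Yc = unitary_groupD[OF Y]
  have "\<exists>l r. strict_mono (r :: nat \<Rightarrow> nat) \<and>
      (\<forall>p\<in>{..<n} \<times> {..<n}. (\<lambda>k. Y (r k) $$ p) \<longlonglongrightarrow> l p)"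
  proof (rule bounded_family_convergent_subsequence)
    show "bounded (range (\<lambda>k. Y k $$ p))" if "p \<in> {..<n} \<times> {..<n}" for p
      unfolding bounded_iff using unitary_entry_le_1[OF Y] that by (cases p) auto
  qed simp
  then obtain l r where r: "strict_mono (r :: nat \<Rightarrow> nat)"
    and l: "\<And>i j. i < n \<Longrightarrow> j < n \<Longrightarrow> (\<lambda>k. Y (r k) $$ (i, j)) \<longlonglongrightarrow> l (i, j)"
    by auto
  define m where "m = (\<lambda>k. r (Suc k) - r k)"
  have less: "r k < r (Suc k)" for k using r by (simp add: strict_mono_Suc_iff)
  have lim: "(\<lambda>k. Y (m k) $$ (i, j)) \<longlonglongrightarrow> (if i = j then 1 else 0)" if ij: "i < n" "j < n" for i j
  proof -
    let ?A = "\<lambda>k. mat_adjoint (Y (r k))"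
    have "Y (r (Suc k)) = Y (m k) * Y (r k)" for k
      using nat_pow_mult[OF U, of "m k" "r k"] less[of k]
      by (simp add: Y_def m_def) (simp add: unitary_group_def)
    then have "Y (r (Suc k)) * ?A k = Y (m k) * (Y (r k) * ?A k)" for k
      using assoc_mult_mat[OF Yc(1) Yc(1) mat_adjoint_carrier[OF Yc(1)]] by simp
    moreover have "Y (r k) * ?A k = 1\<^sub>m n" for k using Y[of "r k"] by (simp add: unitary_group_def)
    ultimately have "Y (m k) = Y (r (Suc k)) * ?A k" for k
      using Yc(1)[of "m k"] by simp
    then have "Y (m k) $$ (i, j) = (\<Sum>p<n. Y (r (Suc k)) $$ (i, p) * cnj (Y (r k) $$ (j, p)))" for k
      using mult_adjoint_index[OF Yc(1) Yc(1) ij] by simp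
    moreover have "(\<lambda>k. \<Sum>p<n. Y (r (Suc k)) $$ (i, p) * cnj (Y (r k) $$ (j, p)))
        \<longlonglongrightarrow> (\<Sum>p<n. l (i, p) * cnj (l (j, p)))"
      using ij by (intro tendsto_sum tendsto_mult tendsto_cnj l LIMSEQ_Suc[of "\<lambda>k. Y (r k) $$ _"]) auto
    \<comment> \<open>The rows of the limit are orthonormal, because those of every
      \<open>Y (r k)\<close> are.\<close>
    moreover have "(\<Sum>p<n. l (i, p) * cnj (l (j, p))) = (if i = j then 1 else 0)"
    proof (rule LIMSEQ_unique)
      show "(\<lambda>k. \<Sum>p<n. Y (r k) $$ (i, p) * cnj (Y (r k) $$ (j, p)))
          \<longlonglongrightarrow> (\<Sum>p<n. l (i, p) * cnj (l (j, p)))"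
        using ij by (intro tendsto_sum tendsto_mult tendsto_cnj l) auto
      show "(\<lambda>k. \<Sum>p<n. Y (r k) $$ (i, p) * cnj (Y (r k) $$ (j, p)))
          \<longlonglongrightarrow> (if i = j then 1 else 0)"
        by (simp add: unitary_rows[OF Y ij])
    qed
    ultimately show ?thesis by simp
  qed
  show ?thesis
    using lim less by (intro exI[of _ m]) (auto simp: Y_def m_def)
qed

text \<open>The hypothesis says that z g^m is conjugate to g^m. Their images have equal trace, and
  along exponents m for which h(g)^m tends to 1 this becomes trace h(z) = n.\<close>

lemma conj_powers_imp_trivial:
  assumes h: "group_hom G (unitary_group n) h"
    and g: "g \<in> carrier G" and z: "z \<in> carrier G"
    and conj: "\<And>m :: nat. m > 0 \<Longrightarrow>
      \<exists>x \<in> carrier G. x \<otimes>\<^bsub>G\<^esub> g [^]\<^bsub>G\<^esub> m = z \<otimes>\<^bsub>G\<^esub> (g [^]\<^bsub>G\<^esub> m \<otimes>\<^bsub>G\<^esub> x)"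
  shows "h z = \<one>\<^bsub>unitary_group n\<^esub>"
proof -
  let ?U = "unitary_group n"
  interpret group_hom G ?U h by (rule h)
  have mult: "A \<otimes>\<^bsub>?U\<^esub> B = A * B" for A B by (simp add: unitary_group_def)
  define Y where "Y = (\<lambda>k :: nat. h g [^]\<^bsub>?U\<^esub> k)"
  have Y: "Y k \<in> carrier ?U" for k using g by (simp add: Y_def)
  have Z: "h z \<in> carrier ?U" using z by simp
  note Yc = unitary_groupD[OF Y] and Zc = unitary_groupD[OF Z]
  obtain m :: "nat \<Rightarrow> nat" where m: "\<And>k. m k > 0"
    and lim: "\<And>i j. i < n \<Longrightarrow> j < n \<Longrightarrow>
      (\<lambda>k. Y (m k) $$ (i, j)) \<longlonglongrightarrow> (if i = j then 1 else 0)"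
    using unitary_powers_recurrent[of "h g" n] g unfolding Y_def by auto
  have tr: "(\<Sum>i<n. (h z * Y k) $$ (i, i)) = (\<Sum>i<n. Y k $$ (i, i))" if "k > 0" for k
  proof -
    obtain x where x: "x \<in> carrier G"
      and eq: "x \<otimes>\<^bsub>G\<^esub> g [^]\<^bsub>G\<^esub> k = z \<otimes>\<^bsub>G\<^esub> (g [^]\<^bsub>G\<^esub> k \<otimes>\<^bsub>G\<^esub> x)"
      using conj[OF \<open>k > 0\<close>] by blast
    let ?A = "mat_adjoint (h x)"
    have X: "h x \<in> carrier ?U" using x by simp
    note Xc = unitary_groupD(1)[OF X] and Ac = mat_adjoint_carrier[OF unitary_groupD(1)[OF X]]
    have XA: "h x * ?A = 1\<^sub>m n" "?A * h x = 1\<^sub>m n" using X by (auto simp: unitary_group_def)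
    have ZY: "h z * Y k \<in> carrier_mat n n" using Zc(1) Yc(1) by (rule mult_carrier_mat)
    have "h x * Y k = h z * (Y k * h x)"
      using arg_cong[OF eq, of h] x g z by (simp add: hom_nat_pow Y_def mult)
    also have "\<dots> = h z * Y k * h x" by (rule assoc_mult_mat[OF Zc(1) Yc(1) Xc, symmetric])
    \<comment> \<open>Written as a conjugate by \<open>h x\<close>, this product has the trace of
      \<open>Y k\<close> by cyclicity.\<close>
    finally have "h z * Y k = h x * Y k * ?A"
      using assoc_mult_mat[OF ZY Xc Ac] XA(1) right_mult_one_mat[OF ZY] by simp
    then have "(\<Sum>i<n. (h z * Y k) $$ (i, i)) = (\<Sum>i<n. (?A * (h x * Y k)) $$ (i, i))"
      using sum_diag_mult_commute[OF mult_carrier_mat[OF Xc Yc(1)] Ac] by simp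
    also have "?A * (h x * Y k) = Y k"
      using assoc_mult_mat[OF Ac Xc Yc(1), of k] XA Yc(1)[of k] by simp
    finally show ?thesis .
  qed
  have ZY_index: "(h z * Y k) $$ (i, i) = (\<Sum>j<n. h z $$ (i, j) * Y k $$ (j, i))" if "i < n" for i k
    using that Zc Yc by (simp add: scalar_prod_def atLeast0LessThan)
  have "(\<Sum>i<n. h z $$ (i, i)) = of_nat n"
  proof (rule LIMSEQ_unique)
    have "(\<lambda>k. \<Sum>i<n. \<Sum>j<n. h z $$ (i, j) * Y (m k) $$ (j, i))
        \<longlonglongrightarrow> (\<Sum>i<n. \<Sum>j<n. h z $$ (i, j) * (if j = i then 1 else 0))"
      by (intro tendsto_sum tendsto_mult tendsto_const lim) auto
    then show "(\<lambda>k. \<Sum>i<n. Y (m k) $$ (i, i)) \<longlonglongrightarrow> (\<Sum>i<n. h z $$ (i, i))"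
      using tr[OF m] by (simp add: ZY_index if_distrib cong: if_cong)
    have "(\<lambda>k. \<Sum>i<n. Y (m k) $$ (i, i)) \<longlonglongrightarrow> (\<Sum>i<n. if i = i then 1 else 0)"
      by (intro tendsto_sum lim) auto
    then show "(\<lambda>k. \<Sum>i<n. Y (m k) $$ (i, i)) \<longlonglongrightarrow> of_nat n" by simp
  qed
  from unitary_trace_eq_imp_one[OF Z this] show ?thesis by (simp add: unitary_group_def)
qed

section \<open>Unitary representations of the McLain group\<close>

lemma transv_pow:
  fixes r :: "'a::ring_1"
  assumes "i < j"
  shows "transv i j r [^]\<^bsub>mclain\<^esub> m = transv i j (of_nat m * r)"
proof (induction m)
  case 0
  then show ?case by (simp add: transv_zero nat_pow_def)
next
  case (Suc m)
  interpret group "mclain :: ('b \<Rightarrow> 'b \<Rightarrow> 'a) monoid" by (rule group_mclain)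
  show ?case using Suc assms by (simp add: transv_add distrib_right add.commute)
qed

lemma weakly_mixing_mclain:
  "weakly_mixing (mclain :: ('i::dense_linorder \<Rightarrow> 'i \<Rightarrow> 'a::field_char_0) monoid)"
  unfolding weakly_mixing_def
proof (intro allI impI ballI)
  let ?G = "mclain :: ('i \<Rightarrow> 'i \<Rightarrow> 'a) monoid"
  fix n h and g :: "'i \<Rightarrow> 'i \<Rightarrow> 'a"
  let ?U = "unitary_group n"
  assume "h \<in> hom ?G ?U" and g: "g \<in> carrier ?G"
  then have hom: "group_hom ?G ?U h"
    by (simp add: group_hom_def group_hom_axioms_def group_mclain group_unitary_group)
  interpret group_hom ?G ?U h by (rule hom)
  have tr: "h (transv i j r) = \<one>\<^bsub>?U\<^esub>" if "i < j" for i j r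
  proof -
    obtain k where k: "i < k" "k < j" using dense[OF \<open>i < j\<close>] by blast
    show ?thesis
    proof (rule conj_powers_imp_trivial[OF hom])
      show "transv k j 1 \<in> carrier ?G" "transv i j r \<in> carrier ?G"
        using that k by (auto intro: transv_closed)
      fix m :: nat assume "m > 0"
      then show "\<exists>x\<in>carrier ?G. x \<otimes>\<^bsub>?G\<^esub> transv k j 1 [^]\<^bsub>?G\<^esub> m =
          transv i j r \<otimes>\<^bsub>?G\<^esub> (transv k j 1 [^]\<^bsub>?G\<^esub> m \<otimes>\<^bsub>?G\<^esub> x)"
        \<comment> \<open>The m-th power of t_kj(1) is t_kj(m), so the parameter r/m makes the
          commutator t_ij(r) independent of m.\<close>
        using transv_commute[of i k j "r / of_nat m" "of_nat m"] k that
        by (intro bexI[of _ "transv i k (r / of_nat m)"]) (auto simp: transv_pow transv_closed)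
    qed
  qed
  from g have "g \<in> strictly_upper" by simp
  then show "h g = \<one>\<^bsub>?U\<^esub>"
  proof (induction rule: strictly_upper_induct)
    case zero
    show ?case using hom_one by simp
  next
    case (transv i j r b)
    then show ?case
      using hom_mult[of "transv i j r" b] tr[of i j r] by (simp add: transv_closed)
  qed
qed

section \<open>Transport along isomorphisms\<close>

lemma orderable_inj_hom:
  assumes "group_hom G H f" "inj_on f (carrier G)" "orderable H"
  shows "orderable G"
proof -
  interpret group_hom G H f by (rule assms)
  obtain r where r: "linear_order_on (carrier H) r"
    and inv: "\<And>a b c. a \<in> carrier H \<Longrightarrow> b \<in> carrier H \<Longrightarrow> c \<in> carrier H \<Longrightarrow> (a, b) \<in> r \<Longrightarrow>
      (c \<otimes>\<^bsub>H\<^esub> a, c \<otimes>\<^bsub>H\<^esub> b) \<in> r \<and> (a \<otimes>\<^bsub>H\<^esub> c, b \<otimes>\<^bsub>H\<^esub> c) \<in> r"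
    using assms(3) unfolding orderable_def by blast
  define s where "s = {(a, b). a \<in> carrier G \<and> b \<in> carrier G \<and> (f a, f b) \<in> r}"
  have "linear_order_on (carrier G) s"
    unfolding order_on_defs
  proof (intro conjI)
    show "refl_on (carrier G) s"
      using r by (auto simp: order_on_defs s_def refl_on_def)
    show "trans s"
      using r by (auto simp: order_on_defs s_def intro!: transI dest: transD)
    show "antisym s"
      using r inj_onD[OF assms(2)] by (auto simp: order_on_defs s_def intro!: antisymI dest: antisymD)
    show "total_on (carrier G) s"
    proof (rule total_onI)
      fix x y assume xy: "x \<in> carrier G" "y \<in> carrier G" "x \<noteq> y"
      then have "f x \<noteq> f y" using inj_on_eq_iff[OF assms(2)] by simp
      then have "(f x, f y) \<in> r \<or> (f y, f x) \<in> r"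
        using r xy by (simp add: order_on_defs total_on_def)
      then show "(x, y) \<in> s \<or> (y, x) \<in> s" using xy by (simp add: s_def)
    qed
  qed (auto simp: s_def)
  then show ?thesis
    unfolding orderable_def using inv by (intro exI[of _ s]) (auto simp: s_def)
qed

lemma locally_solvable_inj_hom:
  assumes "group_hom G H f" "inj_on f (carrier G)" "locally_solvable H"
  shows "locally_solvable G"
  unfolding locally_solvable_def
proof (intro allI impI)
  interpret group_hom G H f by (rule assms)
  fix S assume S: "S \<subseteq> carrier G" "finite S"
  let ?K = "generate G S"
  have fS: "f ` S \<subseteq> carrier H" using S by auto
  have sub: "subgroup ?K G" "subgroup (generate H (f ` S)) H"
    using G.generate_is_subgroup[OF S(1)] H.generate_is_subgroup[OF fS] by auto
  have solv: "solvable (H\<lparr>carrier := generate H (f ` S)\<rparr>)"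
    using assms(3) fS S(2) unfolding locally_solvable_def by simp
  have hom: "group_hom (G\<lparr>carrier := ?K\<rparr>) (H\<lparr>carrier := generate H (f ` S)\<rparr>) f"
    using sub subgroup.subgroup_is_group[OF sub(1)] subgroup.subgroup_is_group[OF sub(2)]
      generate_img[OF S(1)] subgroup.mem_carrier[OF sub(1)]
    by (auto simp: group_hom_def group_hom_axioms_def hom_def)
  have "inj_on f (carrier (G\<lparr>carrier := ?K\<rparr>))"
    using inj_on_subset[OF assms(2) subgroup.subset[OF sub(1)]] by simp
  from group_hom.inj_hom_imp_solvable[OF hom this solv]
  show "solvable (G\<lparr>carrier := ?K\<rparr>)" .
qed

text \<open>Homomorphisms map the derived subgroup onto the derived subgroup of the image.\<close>

lemma perfect_surj_hom:
  assumes "group_hom G H f" "f ` carrier G = carrier H" "perfect G"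
  shows "perfect H"
  using group_hom.derived_img[OF assms(1) order_refl] assms(2,3) by (simp add: perfect_def)

lemma weakly_mixing_surj_hom:
  assumes "group_hom G H f" "f ` carrier G = carrier H" "weakly_mixing G"
  shows "weakly_mixing H"
  unfolding weakly_mixing_def
proof (intro allI impI ballI)
  fix n h y assume n: "n \<ge> 1" and h: "h \<in> hom H (unitary_group n)" and "y \<in> carrier H"
  then obtain x where x: "x \<in> carrier G" "y = f x" using assms(2) by auto
  have "h \<circ> f \<in> hom G (unitary_group n)"
    using group_hom.homh[OF assms(1)] h by (rule hom_compose)
  with assms(3) n x show "h y = \<one>\<^bsub>unitary_group n\<^esub>"
    unfolding weakly_mixing_def by fastforce
qed

theorem corollary3p2:
  shows "\<exists>G :: nat monoid. group G \<and> infinite (carrier G) \<and> countable (carrier G) \<and>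
    orderable G \<and> locally_solvable G \<and> perfect G \<and> weakly_mixing G"
proof -
  let ?M = "mclain :: (rat \<Rightarrow> rat \<Rightarrow> rat) monoid"
  \<comment> \<open>The carrier is countable, so \<open>f\<close> is injective and transports the
    group structure to a set of naturals.\<close>
  define f where "f = to_nat_on (carrier ?M)"
  define G where "G = image_group f ?M"
  interpret M: group ?M by (rule group_mclain)
  have inj: "inj_on f (carrier ?M)"
    unfolding f_def by (rule inj_on_to_nat_on) (simp add: countable_strictly_upper)
  have grp: "group G" unfolding G_def by (rule M.inj_imp_image_group_is_group[OF inj])
  have iso: "f \<in> iso ?M G" unfolding G_def by (rule inj_imp_image_group_iso[OF inj])
  \<comment> \<open>Order and local solvability are pulled back along the inverse \<open>g\<close>;
    perfectness and weak mixing are pushed forward along \<open>f\<close>.\<close>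
  define g where "g = inv_into (carrier ?M) f"
  have iso': "g \<in> iso G ?M" unfolding g_def by (rule M.iso_set_sym[OF iso])
  have f: "group_hom ?M G f" and g: "group_hom G ?M g"
    using iso iso' grp M.is_group by (auto simp: group_hom_def group_hom_axioms_def iso_def)
  have surj: "f ` carrier ?M = carrier G" and injg: "inj_on g (carrier G)"
    using iso iso' by (auto simp: iso_def bij_betw_def)
  have "infinite (carrier ?M)" using infinite_strictly_upper[of "0 :: rat" 1] by simp
  then have "infinite (carrier G)" using surj inj finite_image_iff by metis
  then show ?thesis
    using grp orderable_inj_hom[OF g injg orderable_mclain]
      locally_solvable_inj_hom[OF g injg locally_solvable_mclain]
      perfect_surj_hom[OF f surj perfect_mclain]
      weakly_mixing_surj_hom[OF f surj weakly_mixing_mclain]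
    by (intro exI[of _ G]) simp
qed

end
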